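(* Let $G$ be a finite group with commutator subgroup $G'$, and let $H\subset G'$ be a subset. Then the following statements are equivalent: (a) $H=\pi(S)$ for some sequence $S\in\mathcal F(G)$ such that $[S]$ is an idempotent of the class semigroup $\mathcal C(\mathcal B(G),\mathcal F(G))$. (b) $H=G_0'$ (the commutator subgroup of $G_0$) for some subgroup $G_0\subset G$. Moreover, if $S$ is a sequence as in (a), then (b) holds with $G_0=\langle\mathrm{supp}(S)\rangle$.
   Context: Let $G$ be a finite group with identity $1_G$. $\mathcal F(G)$ is the free abelian monoid with basis $G$, its operation written $\cdot$ ; its elements are called sequences over $G$ (finite, unordered, repetition allowed), its identity is the empty sequence $1_{\mathcal F(G)}$, and $\mathrm{supp}(S)\subset G$ is the set of elements occurring in $S$. For $S=g_1\cdot\ldots\cdot g_\ell$, $\pi(S)=\{g_{\tau(1)}\cdots g_{\tau(\ell)}\in G \mid \tau \text{ a permutation of } [1,\ell]\}$, with $\pi(1_{\mathcal F(G)})=\{1_G\}$. The monoid of product-one sequences is $\mathcal B(G)=\{S\in\mathcal F(G)\mid 1_G\in\pi(S)\}$. For $S,S'\in\mathcal F(G)$ write $S\sim S'$ if for all $T\in\mathcal F(G)$: $S\cdot T\in\mathcal B(G)\Leftrightarrow S'\cdot T\in\mathcal B(G)$. This is a congruence; $[S]$ is the class of $S$, and $\mathcal C(\mathcal B(G),\mathcal F(G))=\{[S]\mid S\in\mathcal F(G)\}$, with $[S]+[S']=[S\cdot S']$, is the class semigroup (a finite commutative semigroup with identity $[1_{\mathcal F(G)}]$). *)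

theory Defs
  imports "HOL-Algebra.Generated_Groups" "HOL-Combinatorics.Multiset_Permutations"
begin

text \<open>
  A sequence over \<open>G\<close> is a multiset with support in the carrier. The operation of the free abelian
  monoid of sequences is the sum of multisets, its identity is the empty multiset, and the support
  of \<open>S\<close> is \<open>set_mset S\<close>.
\<close>

definition sequences :: "('a, 'b) monoid_scheme \<Rightarrow> 'a multiset set" where
  "sequences G = {S. set_mset S \<subseteq> carrier G}"

definition list_product :: "('a, 'b) monoid_scheme \<Rightarrow> 'a list \<Rightarrow> 'a" where
  "list_product G xs = foldr (\<otimes>\<^bsub>G\<^esub>) xs \<one>\<^bsub>G\<^esub>"

text \<open>The set \<open>\<pi>(S)\<close> of the products of the terms of \<open>S\<close>, taken in all possible orders.\<close>

definition products :: "('a, 'b) monoid_scheme \<Rightarrow> 'a multiset \<Rightarrow> 'a set" where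
  "products G S = list_product G ` permutations_of_multiset S"

definition product_one_sequences :: "('a, 'b) monoid_scheme \<Rightarrow> 'a multiset set" where
  "product_one_sequences G = {S \<in> sequences G. \<one>\<^bsub>G\<^esub> \<in> products G S}"

definition seq_equiv :: "('a, 'b) monoid_scheme \<Rightarrow> ('a multiset \<times> 'a multiset) set" where
  "seq_equiv G = {(S, S'). S \<in> sequences G \<and> S' \<in> sequences G \<and>
     (\<forall>T \<in> sequences G. S + T \<in> product_one_sequences G \<longleftrightarrow> S' + T \<in> product_one_sequences G)}"

definition seq_class :: "('a, 'b) monoid_scheme \<Rightarrow> 'a multiset \<Rightarrow> 'a multiset set" where
  "seq_class G S = seq_equiv G `` {S}"

text \<open>
  The class semigroup, written multiplicatively as a monoid record. The union in the operation is
  over singletons that all coincide; see \<open>class_semigroup_mult\<close> below.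
\<close>

definition class_semigroup :: "('a, 'b) monoid_scheme \<Rightarrow> 'a multiset set monoid" where
  "class_semigroup G =
     \<lparr>carrier = sequences G // seq_equiv G,
      monoid.mult = (\<lambda>X Y. the_elem (\<Union>S\<in>X. \<Union>S'\<in>Y. {seq_class G (S + S')})),
      one = seq_class G {#}\<rparr>"

lemma sequences_add: "S + S' \<in> sequences G \<longleftrightarrow> S \<in> sequences G \<and> S' \<in> sequences G"
  by (auto simp: sequences_def)

lemma empty_in_sequences: "{#} \<in> sequences G"
  by (simp add: sequences_def)

lemma products_empty: "products G {#} = {\<one>\<^bsub>G\<^esub>}"
  by (simp add: products_def list_product_def)

lemma equiv_seq_equiv: "equiv (sequences G) (seq_equiv G)"
  by (auto simp: equiv_def refl_on_def sym_def trans_def seq_equiv_def)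

lemma seq_equiv_add:
  assumes "(S, S') \<in> seq_equiv G" and "(T, T') \<in> seq_equiv G"
  shows "(S + T, S' + T') \<in> seq_equiv G"
proof -
  have mem: "S \<in> sequences G" "S' \<in> sequences G" "T \<in> sequences G" "T' \<in> sequences G"
    using assms by (auto simp: seq_equiv_def)
  have "S + T + U \<in> product_one_sequences G \<longleftrightarrow> S' + T' + U \<in> product_one_sequences G"
    if U: "U \<in> sequences G" for U
  proof -
    have "S + (T + U) \<in> product_one_sequences G \<longleftrightarrow> S' + (T + U) \<in> product_one_sequences G"
      using assms(1) mem U by (simp add: seq_equiv_def sequences_add)
    moreover have "T + (S' + U) \<in> product_one_sequences G \<longleftrightarrow> T' + (S' + U) \<in> product_one_sequences G"
      using assms(2) mem U by (simp add: seq_equiv_def sequences_add)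
    ultimately show ?thesis by (simp add: ac_simps)
  qed
  then show ?thesis using mem by (simp add: seq_equiv_def sequences_add)
qed

lemma seq_class_eq_iff:
  assumes "S \<in> sequences G" and "S' \<in> sequences G"
  shows "seq_class G S = seq_class G S' \<longleftrightarrow> (S, S') \<in> seq_equiv G"
  unfolding seq_class_def using assms eq_equiv_class_iff[OF equiv_seq_equiv] by blast

lemma carrier_class_semigroup: "carrier (class_semigroup G) = seq_class G ` sequences G"
  by (auto simp: class_semigroup_def seq_class_def quotient_def)

lemma class_semigroup_mult:
  assumes "S \<in> sequences G" and "S' \<in> sequences G"
  shows "seq_class G S \<otimes>\<^bsub>class_semigroup G\<^esub> seq_class G S' = seq_class G (S + S')"
proof -
  have self: "S \<in> seq_class G S" "S' \<in> seq_class G S'"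
    using assms by (auto simp: seq_class_def seq_equiv_def)
  have "seq_class G (T + T') = seq_class G (S + S')"
    if "T \<in> seq_class G S" "T' \<in> seq_class G S'" for T T'
  proof -
    have "(S + S', T + T') \<in> seq_equiv G"
      using that seq_equiv_add unfolding seq_class_def by blast
    then show ?thesis
      using equiv_class_eq[OF equiv_seq_equiv] unfolding seq_class_def by metis
  qed
  then have "(\<Union>T\<in>seq_class G S. \<Union>T'\<in>seq_class G S'. {seq_class G (T + T')})
      = {seq_class G (S + S')}"
    using self by blast
  then show ?thesis by (simp add: class_semigroup_def)
qed

lemma comm_monoid_class_semigroup: "comm_monoid (class_semigroup G)"
proof -
  have one: "\<one>\<^bsub>class_semigroup G\<^esub> = seq_class G {#}"
    by (simp add: class_semigroup_def)
  show ?thesis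
    by (rule comm_monoidI)
      (auto simp: carrier_class_semigroup class_semigroup_mult one empty_in_sequences
        sequences_add ac_simps)
qed

end

theory Submission
  imports Defs "HOL-Algebra.Multiplicative_Group"
begin

text \<open>
  A sequence \<open>S\<close> is equivalent to \<open>S'\<close> only if \<open>\<pi>(S) = \<pi>(S')\<close>, because \<open>h \<in> \<pi>(S)\<close> says that
  \<open>S \<cdot> h\<^sup>-\<^sup>1\<close> is a product-one sequence. So if \<open>[S]\<close> is idempotent, then \<open>\<pi>(S) = \<pi>(S\<^sup>n)\<close> for all
  \<open>n \<ge> 1\<close>, and \<open>\<pi>(S)\<close> is a nonempty set closed under multiplication, hence a subgroup. With
  \<open>G\<^sub>0 = \<langle>supp(S)\<rangle>\<close>, it lies in \<open>G\<^sub>0'\<close> since reordering changes a product only by an element of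
  \<open>G\<^sub>0'\<close>. For \<open>x, y \<in> G\<^sub>0\<close> written as words in the support, a large power of \<open>S\<close> can be ordered as
  \<open>x y c\<close> and as \<open>y x c\<close>, so \<open>\<pi>(S)\<close> contains the commutator \<open>[x, y]\<close>.

  Conversely, some power \<open>g\<^sup>m\<close> with \<open>m \<ge> 1\<close> of each \<open>g \<in> G\<^sub>0\<close> has an idempotent class, and the
  product of these powers over \<open>G\<^sub>0\<close> is the required sequence. To find it, consider a word with
  more than \<open>|G|\<^sup>2\<close> letters \<open>g\<close>. By the pigeonhole principle the same product is reached before
  \<open>|G| + 1\<close> of these letters, so the word contains \<open>|G|\<close> consecutive factors \<open>g v\<close> of product one.
  Each \<open>v\<close> then has product \<open>g\<^sup>-\<^sup>1\<close>, so after deleting these \<open>|G|\<close> letters \<open>g\<close> the factors multiply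
  to the \<open>|G|\<close>-th power of \<open>g\<^sup>-\<^sup>1\<close>, which is again \<open>1\<close>.
\<close>

section \<open>Products of words and powers of sequences\<close>

lemma list_product_simps [simp]:
  "list_product G [] = \<one>\<^bsub>G\<^esub>"
  "list_product G (x # xs) = x \<otimes>\<^bsub>G\<^esub> list_product G xs"
  by (simp_all add: list_product_def)

text \<open>The fold never looks at the carrier. This identifies products taken in a subgroup,
  viewed as a group of its own, with products in \<open>G\<close>.\<close>

lemma list_product_carrier_update [simp]:
  "list_product (G\<lparr>carrier := A\<rparr>) = list_product G"
  by (simp add: list_product_def fun_eq_iff)

lemma mem_products_iff: "h \<in> products G S \<longleftrightarrow> (\<exists>xs. mset xs = S \<and> list_product G xs = h)"
  by (auto simp: products_def permutations_of_multiset_def)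

text \<open>No multiplicity in \<open>M\<close> exceeds \<open>size M\<close>, while every term of
  \<open>S\<close> occurs at least \<open>size M\<close> times on the right. Words in the support
  thus fit into a power of \<open>S\<close>.\<close>

lemma subset_mset_repeat_mset:
  assumes "set_mset M \<subseteq> set_mset S"
  shows "M \<subseteq># repeat_mset (size M) S"
proof (rule mset_subset_eqI)
  fix x
  show "count M x \<le> count (repeat_mset (size M) S) x"
  proof (cases "x \<in># M")
    case True
    then have "count S x \<ge> 1" using assms by (simp add: subset_iff Suc_le_eq)
    have "count M x \<le> size M * 1" by (simp add: count_le_size)
    also have "\<dots> \<le> size M * count S x" using \<open>count S x \<ge> 1\<close> by (intro mult_le_mono) auto
    finally show ?thesis by simp
  qed (simp add: not_in_iff)
qed

lemma seq_equiv_trans: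
  "(S, T) \<in> seq_equiv G \<Longrightarrow> (T, U) \<in> seq_equiv G \<Longrightarrow> (S, U) \<in> seq_equiv G"
  by (simp add: seq_equiv_def)

context group
begin

lemma list_product_closed [simp]: "set xs \<subseteq> carrier G \<Longrightarrow> list_product G xs \<in> carrier G"
  by (induction xs) auto

lemma list_product_append:
  "set xs \<subseteq> carrier G \<Longrightarrow> set ys \<subseteq> carrier G \<Longrightarrow>
    list_product G (xs @ ys) = list_product G xs \<otimes> list_product G ys"
  by (induction xs) (auto simp: m_assoc)

lemma list_product_replicate:
  "g \<in> carrier G \<Longrightarrow> list_product G (replicate n g) = g [^] n"
  by (induction n) (simp_all, metis nat_pow_Suc nat_pow_Suc2)

lemma products_subset_carrier: "S \<in> sequences G \<Longrightarrow> products G S \<subseteq> carrier G"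
  by (auto simp: mem_products_iff sequences_def)

lemma mem_products_add:
  assumes "S \<in> sequences G" "T \<in> sequences G" "x \<in> products G S" "y \<in> products G T"
  shows "x \<otimes> y \<in> products G (S + T)"
proof -
  obtain xs ys where "mset xs = S" "list_product G xs = x" "mset ys = T" "list_product G ys = y"
    using assms(3,4) by (auto simp: mem_products_iff)
  with assms(1,2) show ?thesis
    unfolding mem_products_iff
    by (intro exI[of _ "xs @ ys"]) (auto simp: list_product_append sequences_def)
qed

section \<open>The congruence determines the product set\<close>

lemma list_product_rotate:
  assumes "set us \<subseteq> carrier G" "a \<in> carrier G" "set vs \<subseteq> carrier G"
    and "list_product G (us @ a # vs) = \<one>"
  shows "list_product G (vs @ us) = inv a"
proof -
  let ?u = "list_product G us" and ?v = "list_product G vs"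
  have "?u \<otimes> (a \<otimes> ?v) = \<one>" using assms by (simp add: list_product_append)
  then have "(a \<otimes> ?v) \<otimes> ?u = \<one>" by (rule inv_comm) (use assms in auto)
  then have "a \<otimes> (?v \<otimes> ?u) = \<one>" using assms by (simp add: m_assoc)
  then have "(?v \<otimes> ?u) \<otimes> a = \<one>" by (rule inv_comm) (use assms in auto)
  then have "inv a = ?v \<otimes> ?u" using assms by (intro inv_equality) auto
  then show ?thesis using assms by (simp add: list_product_append)
qed

text \<open>Membership in the product set becomes a test with the one-term sequence
  \<open>T = {#inv h#}\<close>, which \<open>seq_equiv\<close> respects by definition.\<close>

lemma mem_products_iff_product_one:
  assumes "S \<in> sequences G" "h \<in> carrier G"
  shows "h \<in> products G S \<longleftrightarrow> S + {#inv h#} \<in> product_one_sequences G"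
proof
  assume "h \<in> products G S"
  moreover have "inv h \<in> products G {#inv h#}"
    unfolding mem_products_iff using assms by (intro exI[of _ "[inv h]"]) auto
  ultimately have "h \<otimes> inv h \<in> products G (S + {#inv h#})"
    using assms by (intro mem_products_add) (auto simp: sequences_def)
  then show "S + {#inv h#} \<in> product_one_sequences G"
    using assms by (auto simp: product_one_sequences_def sequences_def)
next
  assume "S + {#inv h#} \<in> product_one_sequences G"
  then obtain xs where xs: "mset xs = S + {#inv h#}" "list_product G xs = \<one>"
    by (auto simp: product_one_sequences_def mem_products_iff)
  have "inv h \<in># mset xs" unfolding xs(1) by simp
  then have "inv h \<in> set xs" by simp
  \<comment> \<open>The letter \<open>inv h\<close> may stand anywhere in the word; cyclic rotation
    preserves product one and brings it to the end, leaving an ordering of \<open>S\<close>.\<close>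
  then obtain us vs where split: "xs = us @ inv h # vs" by (meson split_list)
  with xs(1) have S: "S = mset (vs @ us)" by (simp add: union_commute)
  then have "set us \<subseteq> carrier G" "set vs \<subseteq> carrier G" using assms(1) by (auto simp: sequences_def)
  then have "list_product G (vs @ us) = h"
    using list_product_rotate[of us "inv h" vs] xs(2) split assms(2) by simp
  then show "h \<in> products G S" unfolding mem_products_iff S by blast
qed

lemma products_eq_of_seq_equiv:
  assumes "(S, S') \<in> seq_equiv G"
  shows "products G S = products G S'"
proof -
  have mem: "S \<in> sequences G" "S' \<in> sequences G" using assms by (auto simp: seq_equiv_def)
  have "h \<in> products G S \<longleftrightarrow> h \<in> products G S'" if h: "h \<in> carrier G" for h
  proof -
    have "{#inv h#} \<in> sequences G" using h by (simp add: sequences_def)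
    then have "S + {#inv h#} \<in> product_one_sequences G \<longleftrightarrow> S' + {#inv h#} \<in> product_one_sequences G"
      using assms unfolding seq_equiv_def by blast
    then show ?thesis using mem h by (simp only: mem_products_iff_product_one)
  qed
  then show ?thesis using products_subset_carrier mem by blast
qed

section \<open>Subgroups and commutators in a finite group\<close>

lemma subgroup_of_finite_mult_closed:
  assumes fin: "finite (carrier G)" and K: "K \<subseteq> carrier G" "K \<noteq> {}"
    and closed: "\<And>x y. x \<in> K \<Longrightarrow> y \<in> K \<Longrightarrow> x \<otimes> y \<in> K"
  shows "subgroup K G"
proof (rule subgroupI)
  fix x assume x: "x \<in> K"
  then have xG: "x \<in> carrier G" using K by blast
  have pow: "x [^] Suc n \<in> K" for n
    by (induction n) (use x xG closed in auto)
  have "order G > 0" using fin order_gt_0_iff_finite by blast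
  \<comment> \<open>Only positive powers of \<open>x\<close> are known to lie in \<open>K\<close>.
    Twice the order is at least 2, so the exponent \<open>Suc k\<close> of the inverse is positive
    even in the trivial group.\<close>
  then obtain k where k: "order G + order G = Suc (Suc k)"
    by (intro that[of "order G + order G - 2"]) simp
  have "x [^] (order G + order G) = \<one>"
    using nat_pow_mult[OF xG, of "order G" "order G"] pow_order_eq_1[OF xG] by simp
  then have "x [^] Suc k \<otimes> x = \<one>" unfolding k by simp
  then have "inv x = x [^] Suc k" using xG by (intro inv_equality) auto
  then show "inv x \<in> K" using pow by simp
qed (use K closed in auto)

text \<open>Induction on the first word. If its head \<open>a\<close> stands behind
  \<open>us\<close> in \<open>ys\<close>, then \<open>a u v = [a,u] (u a v)\<close> with
  \<open>[a,u] = a u a^-1 u^-1\<close>. The quotient of the products is therefore the conjugate by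
  \<open>a\<close> of the quotient for the shorter words, times \<open>[a,u]\<close>; normality of
  the derived subgroup absorbs the conjugation.\<close>

lemma derived_of_permuted_products:
  assumes "set xs \<subseteq> carrier G" "mset xs = mset ys"
  shows "list_product G xs \<otimes> inv list_product G ys \<in> derived G (carrier G)"
  using assms
proof (induction xs arbitrary: ys)
  case Nil
  then show ?case using derived_is_subgroup[of "carrier G"] by (auto simp: subgroup.one_closed)
next
  case (Cons a xs)
  interpret D: normal "derived G (carrier G)" G by (rule derived_self_is_normal)
  have "a \<in> set ys" using Cons.prems by (metis list.set_intros(1) mset_eq_setD)
  then obtain us vs where ys: "ys = us @ a # vs" by (meson split_list)
  have xs: "mset xs = mset (us @ vs)" using Cons.prems by (simp add: ys)
  have set: "a \<in> carrier G" "set xs \<subseteq> carrier G" using Cons.prems by auto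
  then have set': "set us \<subseteq> carrier G" "set vs \<subseteq> carrier G"
    using mset_eq_setD[OF xs] by auto
  define x u v where "x = list_product G xs" and "u = list_product G us" and "v = list_product G vs"
  have mem: "x \<in> carrier G" "u \<in> carrier G" "v \<in> carrier G"
    using set set' by (auto simp: x_def u_def v_def)
  have "x \<otimes> inv (u \<otimes> v) \<in> derived G (carrier G)"
    using Cons.IH[OF set(2) xs] set' by (simp add: x_def u_def v_def list_product_append)
  then have "a \<otimes> (x \<otimes> inv (u \<otimes> v)) \<otimes> inv a \<in> derived G (carrier G)"
    using set D.inv_op_closed2 by blast
  moreover have "a \<otimes> u \<otimes> inv a \<otimes> inv u \<in> derived G (carrier G)"
    unfolding derived_def using set mem by (intro generate.incl) blast
  ultimately have "(a \<otimes> (x \<otimes> inv (u \<otimes> v)) \<otimes> inv a) \<otimes> (a \<otimes> u \<otimes> inv a \<otimes> inv u)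
      \<in> derived G (carrier G)"
    by simp
  also have "(a \<otimes> (x \<otimes> inv (u \<otimes> v)) \<otimes> inv a) \<otimes> (a \<otimes> u \<otimes> inv a \<otimes> inv u)
      = a \<otimes> x \<otimes> inv (u \<otimes> (a \<otimes> v))"
  proof -
    have cancel: "inv b \<otimes> (b \<otimes> c) = c" if "b \<in> carrier G" "c \<in> carrier G" for b c
      using that by (simp add: m_assoc[symmetric])
    show ?thesis using set mem by (simp add: inv_mult_group m_assoc cancel)
  qed
  finally show ?case using set' set by (simp add: ys list_product_append x_def u_def v_def)
qed

text \<open>Any ordering of \<open>S\<close> is compared with one of product
  \<open>1\<close>.\<close>

lemma products_subset_derived:
  assumes S: "S \<in> sequences G" and one: "\<one> \<in> products G S"
  shows "products G S \<subseteq> derived G (generate G (set_mset S))"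
proof
  fix p assume "p \<in> products G S"
  then obtain xs where xs: "mset xs = S" "list_product G xs = p"
    by (auto simp: mem_products_iff)
  obtain ys where ys: "mset ys = S" "list_product G ys = \<one>"
    using one by (auto simp: mem_products_iff)
  let ?K = "generate G (set_mset S)"
  have sub: "subgroup ?K G" using S by (intro generate_is_subgroup) (simp add: sequences_def)
  \<comment> \<open>Working in the group \<open>?K\<close> yields commutators of elements of
    \<open>?K\<close>, not merely of \<open>G\<close>.\<close>
  interpret K: group "G\<lparr>carrier := ?K\<rparr>" using sub by (rule subgroup_imp_group)
  have "set xs \<subseteq> ?K" using xs(1) by (auto intro: generate.incl)
  then have "p \<otimes> inv\<^bsub>G\<lparr>carrier := ?K\<rparr>\<^esub> \<one> \<in> derived (G\<lparr>carrier := ?K\<rparr>) ?K"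
    using K.derived_of_permuted_products[of xs ys] xs ys by simp
  moreover have "inv\<^bsub>G\<lparr>carrier := ?K\<rparr>\<^esub> \<one> = \<one>" using K.inv_one by simp
  moreover have "p \<in> carrier G"
    using \<open>p \<in> products G S\<close> products_subset_carrier[OF S] by blast
  ultimately show "p \<in> derived G ?K" using derived_consistent[OF _ sub] by simp
qed

text \<open>In a finite group an inverse is a power with natural exponent, so no inverse letters are
  needed.\<close>

lemma generate_imp_list_product:
  assumes fin: "finite (carrier G)" and A: "A \<subseteq> carrier G" and "x \<in> generate G A"
  shows "\<exists>xs. set xs \<subseteq> A \<and> list_product G xs = x"
  using assms(3)
proof (induction rule: generate.induct)
  case one
  then show ?case by (intro exI[of _ "[]"]) simp
next
  case (incl h)
  then show ?case using A by (intro exI[of _ "[h]"]) auto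
next
  case (inv h)
  then have h: "h \<in> carrier G" using A by blast
  have "order G > 0" using fin order_gt_0_iff_finite by blast
  then have "h [^] (order G - 1) \<otimes> h = \<one>"
    using h pow_order_eq_1[OF h] by (metis Suc_diff_1 nat_pow_Suc)
  then have "inv h = h [^] (order G - 1)" using h by (intro inv_equality) auto
  then show ?case
    using inv h by (intro exI[of _ "replicate (order G - 1) h"]) (auto simp: list_product_replicate)
next
  case (eng h1 h2)
  then obtain xs ys where "set xs \<subseteq> A" "list_product G xs = h1" "set ys \<subseteq> A" "list_product G ys = h2"
    by blast
  then show ?case using A
    by (intro exI[of _ "xs @ ys"]) (auto simp: list_product_append)
qed

section \<open>The product set of an idempotent class\<close>

lemma seq_equiv_repeat_mset:
  assumes "(S + S, S) \<in> seq_equiv G"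
  shows "(repeat_mset (Suc n) S, S) \<in> seq_equiv G"
proof (induction n)
  case 0
  then show ?case using assms by (auto simp: seq_equiv_def)
next
  case (Suc n)
  have "(S, S) \<in> seq_equiv G" using assms by (auto simp: seq_equiv_def)
  then have "(repeat_mset (Suc n) S + S, S + S) \<in> seq_equiv G" using Suc seq_equiv_add by blast
  moreover have "repeat_mset (Suc (Suc n)) S = repeat_mset (Suc n) S + S" by simp
  ultimately show ?case
    using assms seq_equiv_trans by metis
qed

lemma products_idempotent:
  assumes fin: "finite (carrier G)" and idem: "(S + S, S) \<in> seq_equiv G"
  shows "products G S = derived G (generate G (set_mset S))"
proof
  have S: "S \<in> sequences G" using idem by (simp add: seq_equiv_def)
  then have supp: "set_mset S \<subseteq> carrier G" by (simp add: sequences_def)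
  have rep: "products G (repeat_mset (Suc n) S) = products G S" for n
    using products_eq_of_seq_equiv[OF seq_equiv_repeat_mset[OF idem]] .
  have sub: "subgroup (products G S) G"
  proof (rule subgroup_of_finite_mult_closed[OF fin])
    obtain xs where "mset xs = S" using ex_mset by blast
    then show "products G S \<noteq> {}" by (auto simp: products_def permutations_of_multiset_def)
    fix x y assume "x \<in> products G S" "y \<in> products G S"
    then have "x \<otimes> y \<in> products G (S + S)" using mem_products_add S by blast
    then show "x \<otimes> y \<in> products G S" using products_eq_of_seq_equiv[OF idem] by simp
  qed (use products_subset_carrier S in auto)
  then show "products G S \<subseteq> derived G (generate G (set_mset S))"
    using products_subset_derived S subgroup.one_closed by blast
  have comm: "x \<otimes> y \<otimes> inv x \<otimes> inv y \<in> products G S"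
    if xy: "x \<in> generate G (set_mset S)" "y \<in> generate G (set_mset S)" for x y
  proof -
    obtain xs ys where xs: "set xs \<subseteq> set_mset S" "list_product G xs = x"
      and ys: "set ys \<subseteq> set_mset S" "list_product G ys = y"
      using xy generate_imp_list_product[OF fin supp] by meson
    let ?M = "mset (xs @ ys)"
    have "?M \<subseteq># repeat_mset (size ?M) S" using xs ys by (intro subset_mset_repeat_mset) auto
    \<comment> \<open>One more copy of \<open>S\<close> makes the power positive even if both words
      are empty; the zeroth power need not be equivalent to \<open>S\<close>.\<close>
    then have "?M \<subseteq># repeat_mset (Suc (size ?M)) S"
      by (rule subset_mset.order_trans) simp
    then obtain C where C: "repeat_mset (Suc (size ?M)) S = ?M + C"
      by (auto simp: mset_subset_eq_exists_conv)
    obtain cs where cs: "mset cs = C" using ex_mset by blast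
    have "set_mset (repeat_mset n S) \<subseteq> set_mset S" for n
      by (induction n) auto
    then have "set_mset (?M + C) \<subseteq> set_mset S" unfolding C[symmetric] .
    then have mem: "set xs \<subseteq> carrier G" "set ys \<subseteq> carrier G" "set cs \<subseteq> carrier G"
      using supp cs by auto
    define c where "c = list_product G cs"
    have "x \<in> carrier G" "y \<in> carrier G" "c \<in> carrier G" using mem xs ys by (auto simp: c_def)
    note carr = this
    have "mset (xs @ ys @ cs) = ?M + C" "mset (ys @ xs @ cs) = ?M + C"
      using cs by (simp_all add: ac_simps)
    then have "list_product G (xs @ ys @ cs) \<in> products G (?M + C)"
      "list_product G (ys @ xs @ cs) \<in> products G (?M + C)"
      unfolding mem_products_iff by blast+
    then have "x \<otimes> (y \<otimes> c) \<in> products G S" "y \<otimes> (x \<otimes> c) \<in> products G S"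
      using mem xs ys unfolding C[symmetric] rep by (simp_all add: list_product_append c_def)
    \<comment> \<open>The leftover terms are put in the same order behind both words, so their
      product \<open>c\<close> cancels and the commutator remains.\<close>
    then have "(x \<otimes> (y \<otimes> c)) \<otimes> inv (y \<otimes> (x \<otimes> c)) \<in> products G S"
      using subgroup.m_closed[OF sub] subgroup.m_inv_closed[OF sub] by blast
    also have "(x \<otimes> (y \<otimes> c)) \<otimes> inv (y \<otimes> (x \<otimes> c)) = x \<otimes> y \<otimes> inv x \<otimes> inv y"
    proof -
      have "c \<otimes> (inv c \<otimes> b) = b" if "b \<in> carrier G" for b
        using that carr by (simp add: m_assoc[symmetric])
      then show ?thesis using carr by (simp add: inv_mult_group m_assoc)
    qed
    finally show ?thesis .
  qed
  show "derived G (generate G (set_mset S)) \<subseteq> products G S"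
    unfolding derived_def using comm by (intro generate_subgroup_incl[OF _ sub]) blast
qed

section \<open>Deleting repeated letters from long words\<close>

text \<open>Between two positions with the same prefix product \<open>q\<close>, the word has
  product one; more than \<open>k\<close> positions leave at least \<open>k\<close> gaps. Carrying
  \<open>q\<close> in the conclusion lets the induction close the next gap.\<close>

lemma consecutive_one_factors:
  assumes "set xs \<subseteq> carrier G"
    and "card {i. i < length xs \<and> xs ! i = g \<and> list_product G (take i xs) = q} > k"
  shows "\<exists>as vs cs. xs = as @ concat (map ((#) g) vs) @ g # cs \<and> length vs = k \<and>
    list_product G (as @ concat (map ((#) g) vs)) = q \<and> (\<forall>v\<in>set vs. list_product G (g # v) = \<one>)"
  using assms
proof (induction xs arbitrary: k rule: rev_induct)
  case Nil
  then show ?case by simp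
next
  case (snoc x xs)
  let ?I = "\<lambda>xs. {i. i < length xs \<and> xs ! i = g \<and> list_product G (take i xs) = q}"
  have xs: "set xs \<subseteq> carrier G" "x \<in> carrier G" using snoc.prems by auto
  have fin: "finite (?I xs)" by simp
  show ?case
  proof (cases "x = g \<and> list_product G xs = q")
    case True
    then have "?I (xs @ [x]) = insert (length xs) (?I xs)"
      by (auto simp: nth_append less_Suc_eq)
    then have card: "card (?I xs) \<ge> k" using snoc.prems(2) fin by simp
    show ?thesis
    proof (cases k)
      case 0
      then show ?thesis using True
        by (intro exI[of _ xs] exI[of _ "[]"]) auto
    next
      case (Suc l)
      then have "card (?I xs) > l" using card by simp
      from snoc.IH[OF xs(1) this] obtain as vs cs
        where d: "xs = as @ concat (map ((#) g) vs) @ g # cs" "length vs = l"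
        "list_product G (as @ concat (map ((#) g) vs)) = q" "\<forall>v\<in>set vs. list_product G (g # v) = \<one>"
        by blast
      have sub: "set (as @ concat (map ((#) g) vs)) \<subseteq> carrier G" "set (g # cs) \<subseteq> carrier G"
        using xs(1) unfolding d(1) by auto
      \<comment> \<open>The old tail \<open>g # cs\<close> ends just before the new letter
        \<open>g\<close>, where the prefix product is again \<open>q\<close>. It thus becomes one
        more factor.\<close>
      have "q \<otimes> list_product G (g # cs) = q"
        using True list_product_append[OF sub] d(1,3) by (metis append_assoc)
      moreover have "q \<in> carrier G" using sub(1) d(3) list_product_closed by blast
      ultimately have "list_product G (g # cs) = \<one>"
        using r_cancel_one list_product_closed[OF sub(2)] by simp
      then have "\<forall>v\<in>set (vs @ [cs]). list_product G (g # v) = \<one>" using d(4) by auto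
      moreover have eq: "as @ concat (map ((#) g) (vs @ [cs])) = xs" by (simp add: d(1))
      moreover have "xs @ [x] = as @ concat (map ((#) g) (vs @ [cs])) @ g # []"
        using True by (simp add: d(1))
      moreover have "length (vs @ [cs]) = k" using d(2) Suc by simp
      moreover have "list_product G (as @ concat (map ((#) g) (vs @ [cs]))) = q"
        using True unfolding eq by blast
      ultimately show ?thesis by blast
    qed
  next
    case False
    then have "?I (xs @ [x]) = ?I xs" by (auto simp: nth_append less_Suc_eq)
    then have "card (?I xs) > k" using snoc.prems(2) by metis
    from snoc.IH[OF xs(1) this] obtain as vs cs
      where d: "xs = as @ concat (map ((#) g) vs) @ g # cs" "length vs = k"
        "list_product G (as @ concat (map ((#) g) vs)) = q" "\<forall>v\<in>set vs. list_product G (g # v) = \<one>"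
      by blast
    have "xs @ [x] = as @ concat (map ((#) g) vs) @ g # (cs @ [x])" by (simp add: d(1))
    then show ?thesis using d(2-4) by blast
  qed
qed

text \<open>Compares a block of factors before and after deleting the leading letters
  \<open>g\<close>. The two products agree once the number of factors is a multiple of the group
  order.\<close>

lemma list_product_concat_one_factors:
  assumes "g \<in> carrier G" and "\<forall>v\<in>set vs. set v \<subseteq> carrier G \<and> list_product G (g # v) = \<one>"
  shows "list_product G (concat (map ((#) g) vs)) = \<one>"
    and "list_product G (concat vs) = inv g [^] length vs"
proof -
  show "list_product G (concat (map ((#) g) vs)) = \<one>"
    using assms
  proof (induction vs)
    case (Cons v vs)
    have "set (g # v) \<subseteq> carrier G" "set (concat (map ((#) g) vs)) \<subseteq> carrier G"
      using Cons.prems by auto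
    from list_product_append[OF this] show ?case using Cons by simp
  qed simp
  show "list_product G (concat vs) = inv g [^] length vs"
    using assms
  proof (induction vs)
    case (Cons v vs)
    have "set v \<subseteq> carrier G" "set (concat vs) \<subseteq> carrier G"
      using Cons.prems by auto
    note app = list_product_append[OF this]
    have "g \<otimes> list_product G v = \<one>" "list_product G v \<in> carrier G" using Cons.prems by auto
    then have "list_product G v = inv g" using Cons.prems(1) by (metis inv_comm inv_equality)
    then show ?case using Cons app by simp (metis inv_closed nat_pow_Suc nat_pow_Suc2)
  qed simp
qed

text \<open>The threshold is the pigeonhole bound: at most \<open>order G\<close> positions of
  \<open>g\<close> for each of the \<open>order G\<close> possible prefix products give at most
  \<open>order G * order G\<close> occurrences.\<close>

lemma remove_order_copies:
  assumes fin: "finite (carrier G)" and xs: "set xs \<subseteq> carrier G" and g: "g \<in> carrier G"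
    and many: "count (mset xs) g > order G * order G"
  shows "\<exists>ys. mset xs = mset ys + replicate_mset (order G) g \<and> list_product G ys = list_product G xs"
proof -
  let ?J = "\<lambda>q. {i. i < length xs \<and> xs ! i = g \<and> list_product G (take i xs) = q}"
  have "\<exists>q\<in>carrier G. card (?J q) > order G"
  proof (rule ccontr)
    assume "\<not> ?thesis"
    then have small: "card (?J q) \<le> order G" if "q \<in> carrier G" for q using that by force
    have "list_product G (take i xs) \<in> carrier G" for i
      using xs set_take_subset[of i xs] by (intro list_product_closed) blast
    then have "{i. i < length xs \<and> xs ! i = g} = (\<Union>q\<in>carrier G. ?J q)" by auto
    then have "card {i. i < length xs \<and> xs ! i = g} \<le> (\<Sum>q\<in>carrier G. card (?J q))"
      using card_UN_le[OF fin, of ?J] by simp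
    also have "\<dots> \<le> order G * order G"
      using sum_bounded_above[of "carrier G" "\<lambda>q. card (?J q)" "order G"] small
      by (simp add: order_def)
    finally show False using many
      by (simp add: count_mset count_list_eq_length_filter length_filter_conv_card eq_commute[of g])
  qed
  then obtain q where "card (?J q) > order G" by blast
  from consecutive_one_factors[OF xs this] obtain as vs cs
    where d: "xs = as @ concat (map ((#) g) vs) @ g # cs" "length vs = order G"
      "\<forall>v\<in>set vs. list_product G (g # v) = \<one>"
    by blast
  have sub: "set as \<subseteq> carrier G" "set (g # cs) \<subseteq> carrier G"
    "set (concat (map ((#) g) vs)) \<subseteq> carrier G"
    using xs unfolding d(1) by auto
  have "set (concat vs) \<subseteq> set (concat (map ((#) g) vs))" by (induction vs) auto
  with sub(3) have concat: "set (concat vs) \<subseteq> carrier G" by blast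
  have vs: "\<forall>v\<in>set vs. set v \<subseteq> carrier G \<and> list_product G (g # v) = \<one>"
    using concat d(3) by auto
  have "list_product G (concat vs) = \<one>"
    using list_product_concat_one_factors(2)[OF g vs] d(2) g by (simp add: pow_order_eq_1)
  then have "list_product G (as @ concat vs @ g # cs) = list_product G xs"
    using list_product_concat_one_factors(1)[OF g vs] sub concat
    by (simp add: d(1) list_product_append del: list_product_simps)
  moreover have "mset (concat (map ((#) g) us)) = mset (concat us) + replicate_mset (length us) g"
    for us :: "'a list list"
    by (induction us) auto
  then have "mset xs = mset (as @ concat vs @ g # cs) + replicate_mset (order G) g"
    using d(1,2) by simp
  ultimately show ?thesis by blast
qed

text \<open>The bound on \<open>m\<close> allows deletion of \<open>order G\<close> copies whatever
  \<open>T\<close> is. Conversely, \<open>order G\<close> further copies of \<open>g\<close>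
  multiply to \<open>1\<close> and can be appended.\<close>

lemma seq_equiv_replicate_mset_add_order:
  assumes fin: "finite (carrier G)" and g: "g \<in> carrier G" and m: "m > order G * order G"
  shows "(replicate_mset (m + order G) g, replicate_mset m g) \<in> seq_equiv G"
proof -
  have seqs: "replicate_mset n g \<in> sequences G" for n using g by (auto simp: sequences_def)
  have split: "replicate_mset (m + order G) g = replicate_mset m g + replicate_mset (order G) g"
    by (simp add: multiset_eq_iff)
  have "replicate_mset (m + order G) g + T \<in> product_one_sequences G
      \<longleftrightarrow> replicate_mset m g + T \<in> product_one_sequences G" if T: "T \<in> sequences G" for T
  proof
    assume "replicate_mset (m + order G) g + T \<in> product_one_sequences G"
    then obtain xs where x: "mset xs = replicate_mset (m + order G) g + T" "list_product G xs = \<one>"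
      by (auto simp: product_one_sequences_def mem_products_iff)
    have "set xs = set_mset (replicate_mset (m + order G) g + T)"
      using x(1) by (metis set_mset_mset)
    then have "set xs \<subseteq> carrier G"
      using T seqs[of "m + order G"] by (simp add: sequences_def)
    moreover have "count (mset xs) g > order G * order G" using m by (simp add: x(1))
    ultimately obtain ys where "mset xs = mset ys + replicate_mset (order G) g"
      "list_product G ys = \<one>"
      using remove_order_copies[OF fin _ g] x(2) by metis
    moreover from this(1) have "mset ys + replicate_mset (order G) g
        = (replicate_mset m g + T) + replicate_mset (order G) g"
      unfolding x(1) split by (simp only: ac_simps)
    then have "mset ys = replicate_mset m g + T" by (simp only: add_right_cancel)
    ultimately have "mset ys = replicate_mset m g + T" "list_product G ys = \<one>" by blast+
    then show "replicate_mset m g + T \<in> product_one_sequences G"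
      using T seqs unfolding product_one_sequences_def mem_products_iff
      by (auto simp: sequences_add)
  next
    assume "replicate_mset m g + T \<in> product_one_sequences G"
    then have "\<one> \<in> products G (replicate_mset m g + T)" by (simp add: product_one_sequences_def)
    moreover have "\<one> \<in> products G (replicate_mset (order G) g)"
      unfolding mem_products_iff using g
      by (intro exI[of _ "replicate (order G) g"])
        (simp add: list_product_replicate pow_order_eq_1)
    ultimately have "\<one> \<otimes> \<one> \<in> products G (replicate_mset m g + T + replicate_mset (order G) g)"
      using T seqs by (intro mem_products_add) (auto simp: sequences_add)
    then show "replicate_mset (m + order G) g + T \<in> product_one_sequences G"
      using T seqs by (simp add: product_one_sequences_def sequences_add split ac_simps)
  qed
  then show ?thesis using seqs by (simp add: seq_equiv_def)
qed

section \<open>Idempotent classes with prescribed support\<close>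

lemma ex_idempotent_replicate_mset:
  assumes fin: "finite (carrier G)"
  obtains m where "m > 0"
    and "\<And>g. g \<in> carrier G \<Longrightarrow>
      (replicate_mset m g + replicate_mset m g, replicate_mset m g) \<in> seq_equiv G"
proof
  \<comment> \<open>This exponent exceeds the square of the order and is a multiple of the order, so
    steps of length \<open>order G\<close> lead from \<open>?m\<close> to
    \<open>?m + ?m\<close>.\<close>
  let ?m = "Suc (order G) * order G"
  have pos: "order G > 0" using fin order_gt_0_iff_finite by blast
  then show "?m > 0" by simp
  fix g assume g: "g \<in> carrier G"
  have "(replicate_mset (?m + k * order G) g, replicate_mset ?m g) \<in> seq_equiv G" for k
  proof (induction k)
    case 0
    then show ?case using g by (auto simp: seq_equiv_def sequences_def)
  next
    case (Suc k)
    have "(replicate_mset ((?m + k * order G) + order G) g, replicate_mset (?m + k * order G) g)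
        \<in> seq_equiv G"
      using pos by (intro seq_equiv_replicate_mset_add_order[OF fin g]) simp
    moreover have "(?m + k * order G) + order G = ?m + Suc k * order G" by simp
    ultimately show ?case using Suc seq_equiv_trans by metis
  qed
  moreover have "replicate_mset ?m g + replicate_mset ?m g = replicate_mset (?m + ?m) g"
    by (rule multiset_eqI) simp
  \<comment> \<open>This is the case \<open>k = Suc (order G)\<close>.\<close>
  ultimately show "(replicate_mset ?m g + replicate_mset ?m g, replicate_mset ?m g) \<in> seq_equiv G"
    by metis
qed

text \<open>Idempotents of a commutative semigroup multiply to idempotents, and \<open>m > 0\<close>
  makes every element of \<open>A\<close> occur.\<close>

lemma ex_idempotent_with_support:
  assumes fin: "finite (carrier G)" and A: "A \<subseteq> carrier G"
  shows "\<exists>S. set_mset S = A \<and> (S + S, S) \<in> seq_equiv G"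
proof -
  obtain m where m: "m > 0" "\<And>g. g \<in> carrier G \<Longrightarrow>
      (replicate_mset m g + replicate_mset m g, replicate_mset m g) \<in> seq_equiv G"
    using ex_idempotent_replicate_mset[OF fin] by blast
  have "finite A" using fin A finite_subset by blast
  then show ?thesis using A
  proof (induction A rule: finite_induct)
    case empty
    then show ?case by (auto simp: seq_equiv_def empty_in_sequences)
  next
    case (insert g A)
    then obtain S where S: "set_mset S = A" "(S + S, S) \<in> seq_equiv G" by blast
    let ?R = "replicate_mset m g"
    have "((?R + ?R) + (S + S), ?R + S) \<in> seq_equiv G"
      using m(2) insert.prems S(2) by (intro seq_equiv_add) auto
    then have "((?R + S) + (?R + S), ?R + S) \<in> seq_equiv G" by (simp add: ac_simps)
    then show ?case using S(1) m(1) by (intro exI[of _ "?R + S"]) auto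
  qed
qed

end

theorem proposition3p3:
  fixes G (structure) and H :: "'a set"
  assumes "group G" and "finite (carrier G)"
    and "H \<subseteq> derived G (carrier G)"
  shows "((\<exists>S \<in> sequences G. H = products G S \<and>
             seq_class G S \<otimes>\<^bsub>class_semigroup G\<^esub> seq_class G S = seq_class G S)
          \<longleftrightarrow> (\<exists>G\<^sub>0. subgroup G\<^sub>0 G \<and> H = derived G G\<^sub>0))
       \<and> (\<forall>S \<in> sequences G. H = products G S \<and>
             seq_class G S \<otimes>\<^bsub>class_semigroup G\<^esub> seq_class G S = seq_class G S
          \<longrightarrow> subgroup (generate G (set_mset S)) G \<and> H = derived G (generate G (set_mset S)))"
proof -
  interpret group G by fact
  have idem: "seq_class G S \<otimes>\<^bsub>class_semigroup G\<^esub> seq_class G S = seq_class G S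
      \<longleftrightarrow> (S + S, S) \<in> seq_equiv G" if "S \<in> sequences G" for S
    using that by (simp add: class_semigroup_mult seq_class_eq_iff sequences_add)
  have support: "subgroup (generate G (set_mset S)) G \<and> H = derived G (generate G (set_mset S))"
    if "S \<in> sequences G" "H = products G S" "(S + S, S) \<in> seq_equiv G" for S
    using that products_idempotent[OF assms(2)] generate_is_subgroup
    by (simp add: sequences_def)
  have "\<exists>S \<in> sequences G. H = products G S \<and> (S + S, S) \<in> seq_equiv G"
    if K: "subgroup K G" "H = derived G K" for K
  proof -
    \<comment> \<open>The support is all of \<open>K\<close>, so that it generates exactly
      \<open>K\<close>.\<close>
    obtain S where S: "set_mset S = K" "(S + S, S) \<in> seq_equiv G"
      using ex_idempotent_with_support[OF assms(2) subgroup.subset[OF K(1)]] by blast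
    have "generate G K = K"
      using generateI[OF K(1) subset_refl] by simp
    then have "H = products G S" using products_idempotent[OF assms(2) S(2)] S(1) K(2) by simp
    then show ?thesis using S(2) by (auto simp: seq_equiv_def)
  qed
  then have "(\<exists>S \<in> sequences G. H = products G S \<and> (S + S, S) \<in> seq_equiv G)
      \<longleftrightarrow> (\<exists>K. subgroup K G \<and> H = derived G K)"
    using support by (intro iffI) blast+
  with support show ?thesis by (simp add: idem cong: conj_cong bex_cong)
qed

end
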